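(* Let $\mathbb{K}$ be a field of characteristic $0$, let $f\in R_n=\mathbb{K}[x_1,\dots,x_n]$ be a non-zero polynomial with Bernstein-Sato polynomial $b_f(s)$, let $\{P_1(s),\dots,P_k(s)\}$ be a system of generators of the left ideal $\operatorname{Ann}_{D_n[s]}(f^s)$ of $D_n[s]$, and let $\alpha\in\mathbb{Q}_{>0}$. The following conditions are equivalent: (1) $\alpha$ is a root of $b_f(-s)$; (2) $D_n[s]\langle P_1(s),\dots,P_k(s),f,s+\alpha\rangle\neq D_n[s]$; (3) $D_n\langle P_1(-\alpha),\dots,P_k(-\alpha),f\rangle\neq D_n$. Moreover, in such a case $D_n[s]\langle P_1(s),\dots,P_k(s),f,s+\alpha\rangle\cap\mathbb{K}[s]=\mathbb{K}[s]\langle s+\alpha\rangle$.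
   Context: $D_n$ is the $n$-th Weyl algebra, generated over $\mathbb{K}$ by $x_1,\dots,x_n,\partial_1,\dots,\partial_n$ with relations $\partial_i x_j=x_j\partial_i+\delta_{ij}$, $x_jx_i=x_ix_j$, $\partial_j\partial_i=\partial_i\partial_j$; $D_n[s]=D_n\otimes_{\mathbb{K}}\mathbb{K}[s]$ (so $s$ is central), and $P(-\alpha)\in D_n$ is obtained from $P(s)\in D_n[s]$ by substituting $s=-\alpha$. $D_n[s]\langle\dots\rangle$ and $D_n\langle\dots\rangle$ denote the left ideals generated by the listed elements. $M=R_n[s,\frac1f]\cdot f^s$ is the free $R_n[s,\frac1f]$-module of rank one generated by the symbol $f^s$, a left $D_n[s]$-module via $\partial_i(g\cdot f^s)=\big(\frac{\partial g}{\partial x_i}+s\,g\,\frac{\partial f}{\partial x_i}\frac1f\big)\cdot f^s$. $\operatorname{Ann}_{D_n[s]}(f^s)$ is the left ideal of all $P(s)\in D_n[s]$ with $P(s)\cdot f^s=0$. The Bernstein-Sato polynomial $b_f(s)\in\mathbb{K}[s]$ is the monic polynomial of minimal degree for which there is $P(s)\in D_n[s]$ with $P(s)f\cdot f^s=b_f(s)\cdot f^s$ in $M$; equivalently $\langle b_f(s)\rangle=(\operatorname{Ann}_{D_n[s]}(f^s)+D_n[s]\langle f\rangle)\cap\mathbb{K}[s]$. *)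

theory Defs
  imports "HOL-Library.Poly_Mapping" "HOL-Computational_Algebra.Computational_Algebra"
begin

abbreviation "lookup \<equiv> Poly_Mapping.lookup"
abbreviation "keys \<equiv> Poly_Mapping.keys"
abbreviation "monomial \<equiv> Poly_Mapping.single"

section \<open>One-sided and two-sided ideals of noncommutative rings\<close>

definition left_ideal :: "'a::ring_1 set \<Rightarrow> bool" where
  "left_ideal I \<longleftrightarrow> 0 \<in> I \<and> (\<forall>a\<in>I. \<forall>b\<in>I. a + b \<in> I) \<and> (\<forall>r. \<forall>a\<in>I. r * a \<in> I)"

definition two_sided_ideal :: "'a::ring_1 set \<Rightarrow> bool" where
  "two_sided_ideal I \<longleftrightarrow> left_ideal I \<and> (\<forall>r. \<forall>a\<in>I. a * r \<in> I)"

definition left_ideal_gen :: "'a::ring_1 set \<Rightarrow> 'a set" where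
  "left_ideal_gen S = left_ideal hull S"

lemma left_ideal_left_ideal_gen: "left_ideal (left_ideal_gen S)"
  unfolding left_ideal_gen_def by (rule hull_in) (auto simp: left_ideal_def)

lemma two_sided_ideal_hull: "two_sided_ideal (two_sided_ideal hull S)"
  by (rule hull_in) (auto simp: left_ideal_def two_sided_ideal_def)

section \<open>The polynomial ring \<open>R\<^sub>n\<close> and its partial derivatives\<close>

text \<open>
  The variables are indexed by a finite type \<open>'n\<close>, so \<open>n = CARD('n)\<close>. A linear order on
  the index type is required because the library derives absence of zero divisors for
  polynomials from it.
\<close>

type_synonym ('n, 'k) mpoly = "('n \<Rightarrow>\<^sub>0 nat) \<Rightarrow>\<^sub>0 'k"

definition pdiff :: "'n \<Rightarrow> ('n, 'k::comm_ring_1) mpoly \<Rightarrow> ('n, 'k) mpoly" where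
  "pdiff i p = (\<Sum>a\<in>keys p. monomial (a - monomial i 1)
                                (of_nat (lookup a i) * lookup p a))"

lemma poly_mapping_add_induct [case_names single add]:
  assumes "\<And>k c. P (monomial k c)"
    and "\<And>p q. P p \<Longrightarrow> P q \<Longrightarrow> P (p + q)"
  shows "P (p :: 'a \<Rightarrow>\<^sub>0 'b::comm_monoid_add)"
proof (induction p rule: update_induct)
  case const
  then show ?case using assms(1)[of undefined 0] by simp
next
  case (update p k c)
  have "Poly_Mapping.update k c p = p + monomial k c"
    using update(1)
    by (intro poly_mapping_eqI)
       (auto simp: lookup_update lookup_add lookup_single when_def in_keys_iff)
  then show ?case using assms update by simp
qed

lemma keys_sum_single:
  assumes "g k 0 = 0"
  shows "(\<Sum>x\<in>keys (monomial k c). g x (lookup (monomial k c) x)) = g k c"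
  using assms by (cases "c = 0") auto

lemma keys_sum_add:
  assumes "\<And>k. g k 0 = 0" "\<And>k c d. g k (c + d) = g k c + g k d"
  shows "(\<Sum>x\<in>keys (p + q). g x (lookup (p + q) x))
           = (\<Sum>x\<in>keys p. g x (lookup p x)) + (\<Sum>x\<in>keys q. g x (lookup q x))"
  by (rule setsum_keys_plus_distrib) (use assms in auto)

lemma pdiff_single [simp]:
  "pdiff i (monomial a c)
     = monomial (a - monomial i 1) (of_nat (lookup a i) * c)"
  unfolding pdiff_def
  by (rule keys_sum_single[where g = "\<lambda>a c. monomial (a - monomial i 1)
                                (of_nat (lookup a i) * c)"]) simp

lemma pdiff_add [simp]: "pdiff i (p + q) = pdiff i p + pdiff i q"
  unfolding pdiff_def
  by (rule keys_sum_add[where g = "\<lambda>a c. monomial (a - monomial i 1)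
                                (of_nat (lookup a i) * c)"])
     (simp_all add: algebra_simps single_add)

lemma pdiff_0 [simp]: "pdiff i 0 = 0"
  by (simp add: pdiff_def)

lemma pdiff_1 [simp]: "pdiff i 1 = 0"
  by (simp flip: single_one)

lemma pdiff_sum: "pdiff i (sum g A) = (\<Sum>x\<in>A. pdiff i (g x))"
  by (induction A rule: infinite_finite_induct) auto

lemma pdiff_mult: "pdiff i (p * q) = pdiff i p * q + p * pdiff i q"
proof (induction p rule: poly_mapping_add_induct)
  case (single a c)
  show ?case
  proof (induction q rule: poly_mapping_add_induct)
    case (single b d)
    let ?e = "monomial i (1::nat)"
    have *: "x - ?e + y = x + y - ?e" if "lookup x i \<noteq> 0" for x y
      using that by (intro poly_mapping_eqI) (auto simp: lookup_add lookup_minus lookup_single when_def)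
    have 1: "monomial (a - ?e + b) (of_nat (lookup a i) * c * d)
           = monomial (a + b - ?e) (of_nat (lookup a i) * c * d)"
      using *[of a b] by (cases "lookup a i = 0") auto
    have 2: "monomial (b - ?e + a) (of_nat (lookup b i) * c * d)
           = monomial (a + b - ?e) (of_nat (lookup b i) * c * d)"
      using *[of b a] by (cases "lookup b i = 0") (auto simp: add.commute)
    show ?case using 1 2
      by (simp add: mult_single lookup_add algebra_simps single_add)
  qed (simp add: algebra_simps)
qed (simp add: algebra_simps)

lemma pdiff_commute: "pdiff i (pdiff j p) = pdiff j (pdiff i p)"
proof (induction p rule: poly_mapping_add_induct)
  case (single a c)
  have "a - monomial j 1 - monomial i 1
        = a - monomial i (1::nat) - monomial j 1"
    by (intro poly_mapping_eqI) (auto simp: lookup_minus)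
  then show ?case
    by (cases "i = j") (simp_all add: lookup_minus lookup_single algebra_simps)
qed simp

section \<open>The free module of rank one generated by \<open>f\<^sup>s\<close>\<close>

text \<open>
  The localisation of \<open>R\<^sub>n[s]\<close> at the powers of \<open>f\<close> is realised inside the field of fractions
  of the domain \<open>R\<^sub>n[s]\<close>, and \<open>g \<cdot> f\<^sup>s\<close> is represented by its coefficient \<open>g\<close>.
\<close>

type_synonym ('n, 'k) mfract = "('n, 'k) mpoly poly fract"

definition mfract_of :: "('n::linorder, 'k::field) mpoly \<Rightarrow> ('n, 'k) mfract" where
  "mfract_of g = to_fract [:g:]"

definition s_mfract :: "('n::linorder, 'k::field) mfract" where
  "s_mfract = to_fract [:0, 1:]"

definition localization :: "('n::linorder, 'k::field) mpoly \<Rightarrow> ('n, 'k) mfract set" where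
  "localization f = {to_fract g / mfract_of f ^ m | g m. True}"

definition f_power_s :: "('n::linorder, 'k::field) mfract" where
  "f_power_s = 1"

lemma coeff_map_poly_pdiff [simp]: "coeff (map_poly (pdiff i) p) m = pdiff i (coeff p m)"
  by (simp add: coeff_map_poly)

lemma map_poly_pdiff_mult:
  "map_poly (pdiff i) (p * q) = map_poly (pdiff i) p * q + p * map_poly (pdiff i) q"
  by (rule poly_eqI) (simp add: coeff_mult pdiff_sum pdiff_mult sum.distrib)

text \<open>
  The extension of \<open>\<partial>/\<partial>x\<^sub>i\<close> by the quotient rule, with \<open>s\<close> a constant; independence of the
  representing fraction is \<open>fdiff_Fract\<close>.
\<close>

definition fdiff :: "'n \<Rightarrow> ('n::linorder, 'k::field) mfract \<Rightarrow> ('n, 'k) mfract" where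
  "fdiff i x = (THE y. \<exists>a b. b \<noteq> 0 \<and> x = Fract a b \<and>
                 y = Fract (map_poly (pdiff i) a * b - a * map_poly (pdiff i) b) (b * b))"

lemma fdiff_Fract:
  assumes "b \<noteq> 0"
  shows "fdiff i (Fract a b) = Fract (map_poly (pdiff i) a * b - a * map_poly (pdiff i) b) (b * b)"
  unfolding fdiff_def
proof (rule the_equality)
  let ?D = "map_poly (pdiff i)"
  fix y assume "\<exists>c d. d \<noteq> 0 \<and> Fract a b = Fract c d \<and> y = Fract (?D c * d - c * ?D d) (d * d)"
  then obtain c d where cd: "d \<noteq> 0" "Fract a b = Fract c d" "y = Fract (?D c * d - c * ?D d) (d * d)"
    by blast
  then have *: "a * d = c * b" using assms by (simp add: eq_fract)
  then have "?D (a * d) = ?D (c * b)" by simp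
  then have "?D a * d + a * ?D d = ?D c * b + c * ?D b"
    by (simp add: map_poly_pdiff_mult)
  with * have "(?D a * b - a * ?D b) * (d * d) = (?D c * d - c * ?D d) * (b * b)"
    by algebra
  then show "y = Fract (?D a * b - a * ?D b) (b * b)"
    using assms cd by (simp add: eq_fract)
qed (use assms in blast)

lemma map_poly_pdiff_add:
  "map_poly (pdiff i) (p + q) = map_poly (pdiff i) p + map_poly (pdiff i) q"
  by (rule poly_eqI) simp

lemma fdiff_add: "fdiff i (x + y) = fdiff i x + fdiff i y"
  by (cases x, cases y)
     (simp add: fdiff_Fract eq_fract map_poly_pdiff_add map_poly_pdiff_mult algebra_simps)

lemma fdiff_mult: "fdiff i (x * y) = fdiff i x * y + x * fdiff i y"
  by (cases x, cases y)
     (simp add: fdiff_Fract eq_fract map_poly_pdiff_add map_poly_pdiff_mult algebra_simps)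

lemma fdiff_to_fract: "fdiff i (to_fract p) = to_fract (map_poly (pdiff i) p)"
  by (simp add: to_fract_def fdiff_Fract map_poly_pdiff_mult one_pCons map_poly_pCons)

lemma fdiff_0 [simp]: "fdiff i 0 = 0"
  by (metis add.right_neutral add_left_imp_eq fdiff_add)

lemma fdiff_const [simp]: "fdiff i (mfract_of (monomial 0 c)) = 0"
  by (simp add: mfract_of_def fdiff_to_fract map_poly_pCons)

lemma fdiff_s [simp]: "fdiff i s_mfract = 0"
  by (simp add: s_mfract_def fdiff_to_fract map_poly_pCons flip: single_one)

lemma fdiff_mfract_of: "fdiff i (mfract_of g) = mfract_of (pdiff i g)"
  by (simp add: mfract_of_def fdiff_to_fract map_poly_pCons)

lemma mfract_of_add: "mfract_of (g + h) = mfract_of g + mfract_of h"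
  by (simp add: mfract_of_def flip: to_fract_add)

lemma mfract_of_mult: "mfract_of (g * h) = mfract_of g * mfract_of h"
  by (simp add: mfract_of_def flip: to_fract_mult)

lemma mfract_of_0 [simp]: "mfract_of 0 = 0"
  by (simp add: mfract_of_def)

lemma mfract_of_1 [simp]: "mfract_of 1 = 1"
  by (simp add: mfract_of_def flip: one_pCons)

lemma mfract_of_eq_0_iff [simp]: "mfract_of g = 0 \<longleftrightarrow> g = 0"
  by (simp add: mfract_of_def)

lemma fdiff_commute: "fdiff i (fdiff j x) = fdiff j (fdiff i x)"
proof (cases x)
  case (Fract a b)
  have D: "map_poly (pdiff i) (map_poly (pdiff j) p) = map_poly (pdiff j) (map_poly (pdiff i) p)"
    for p :: "('a, 'b) mpoly poly"
    by (rule poly_eqI) (simp add: pdiff_commute)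
  let ?B = "to_fract b"
  have "x * ?B = to_fract a"
    using Fract by (simp add: Fract_conv_to_fract)
  then have "fdiff i (fdiff j (x * ?B)) = fdiff j (fdiff i (x * ?B))"
    by (simp add: fdiff_to_fract D)
  then have "fdiff i (fdiff j x) * ?B = fdiff j (fdiff i x) * ?B"
    by (simp add: fdiff_mult fdiff_add fdiff_to_fract D algebra_simps)
  then show ?thesis using Fract by simp
qed

lemma fdiff_commute_quot:
  "fdiff i (mfract_of (pdiff j f) / mfract_of f) = fdiff j (mfract_of (pdiff i f) / mfract_of f)"
proof (cases "f = 0")
  case False
  have *: "fdiff i (mfract_of g / mfract_of f)
      = (fdiff i (mfract_of g) * mfract_of f - mfract_of g * fdiff i (mfract_of f)) / mfract_of f ^ 2"
    for i g
  proof -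
    have "fdiff i (mfract_of g) = fdiff i (mfract_of g / mfract_of f * mfract_of f)"
      using False by simp
    also have "\<dots> = fdiff i (mfract_of g / mfract_of f) * mfract_of f
                     + mfract_of g / mfract_of f * fdiff i (mfract_of f)"
      by (rule fdiff_mult)
    finally show ?thesis using False by (simp add: field_simps power2_eq_square)
  qed
  show ?thesis by (simp add: * fdiff_mfract_of pdiff_commute[of i j])
qed simp

section \<open>The Weyl algebra\<close>

text \<open>
  The free associative algebra on a set of generators is the monoid algebra of the free monoid
  of words; multiplication of finitely supported functions is convolution.
\<close>

datatype 'g fword = Word (letters: "'g list")

instantiation fword :: (type) monoid_add
begin

definition zero_fword :: "'a fword" where
  "zero_fword = Word []"

definition plus_fword :: "'a fword \<Rightarrow> 'a fword \<Rightarrow> 'a fword" where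
  "plus_fword u v = Word (letters u @ letters v)"

instance
  by standard (simp_all add: zero_fword_def plus_fword_def)

end

datatype 'n weyl_gen = Gen_X 'n | Gen_D 'n

type_synonym ('n, 'k) weyl_free = "'n weyl_gen fword \<Rightarrow>\<^sub>0 'k"

definition free_x :: "'n \<Rightarrow> ('n, 'k::field) weyl_free" where
  "free_x i = monomial (Word [Gen_X i]) 1"

definition free_d :: "'n \<Rightarrow> ('n, 'k::field) weyl_free" where
  "free_d i = monomial (Word [Gen_D i]) 1"

definition weyl_relations :: "('n, 'k::field) weyl_free set" where
  "weyl_relations =
     {free_d i * free_x j - free_x j * free_d i - (if i = j then 1 else 0) | i j. True}
   \<union> {free_x j * free_x i - free_x i * free_x j | i j. True}
   \<union> {free_d j * free_d i - free_d i * free_d j | i j. True}"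

definition weyl_eq :: "('n, 'k::field) weyl_free \<Rightarrow> ('n, 'k) weyl_free \<Rightarrow> bool" where
  "weyl_eq p q \<longleftrightarrow> p - q \<in> two_sided_ideal hull weyl_relations"

lemma
  assumes "two_sided_ideal I"
  shows two_sided_ideal_0: "0 \<in> I"
    and two_sided_ideal_add: "a \<in> I \<Longrightarrow> b \<in> I \<Longrightarrow> a + b \<in> I"
    and two_sided_ideal_lmult: "a \<in> I \<Longrightarrow> r * a \<in> I"
    and two_sided_ideal_rmult: "a \<in> I \<Longrightarrow> a * r \<in> I"
  using assms by (auto simp: two_sided_ideal_def left_ideal_def)

lemma two_sided_ideal_uminus: "two_sided_ideal I \<Longrightarrow> a \<in> I \<Longrightarrow> - a \<in> I"
  using two_sided_ideal_lmult[of I a "- 1"] by simp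

lemma equivp_weyl_eq: "equivp (weyl_eq :: ('n, 'k::field) weyl_free \<Rightarrow> _)"
proof (rule equivpI)
  let ?R = "weyl_eq :: ('n, 'k) weyl_free \<Rightarrow> _"
  note I = two_sided_ideal_hull[of weyl_relations]
  show "reflp ?R"
    by (rule reflpI) (simp add: weyl_eq_def two_sided_ideal_0[OF I])
  show "symp ?R"
  proof (rule sympI)
    fix p q :: "('n, 'k) weyl_free" assume "weyl_eq p q"
    then show "weyl_eq q p"
      using two_sided_ideal_uminus[OF I, of "p - q"] by (simp add: weyl_eq_def)
  qed
  show "transp ?R"
  proof (rule transpI)
    fix p q r :: "('n, 'k) weyl_free" assume "weyl_eq p q" "weyl_eq q r"
    then show "weyl_eq p r"
      using two_sided_ideal_add[OF I, of "p - q" "q - r"] by (simp add: weyl_eq_def)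
  qed
qed

quotient_type (overloaded) ('n, 'k) weyl = "('n, 'k::field) weyl_free" / weyl_eq
  by (rule equivp_weyl_eq)

subsection \<open>The action of the generators on \<open>M\<close>\<close>

primrec gen_act ::
  "('n::linorder, 'k::field) mpoly \<Rightarrow> 'n weyl_gen \<Rightarrow> ('n, 'k) mfract \<Rightarrow> ('n, 'k) mfract" where
  "gen_act f (Gen_X i) g = mfract_of (monomial (monomial i 1) 1) * g"
| "gen_act f (Gen_D i) g = fdiff i g + s_mfract * g * (mfract_of (pdiff i f) / mfract_of f)"

definition word_act ::
  "('n::linorder, 'k::field) mpoly \<Rightarrow> 'n weyl_gen fword \<Rightarrow> ('n, 'k) mfract \<Rightarrow> ('n, 'k) mfract" where
  "word_act f w g = foldr (gen_act f) (letters w) g"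

definition free_act ::
  "('n::linorder, 'k::field) mpoly \<Rightarrow> ('n, 'k) weyl_free \<Rightarrow> ('n, 'k) mfract \<Rightarrow> ('n, 'k) mfract" where
  "free_act f p g = (\<Sum>w\<in>keys p. mfract_of (monomial 0 (lookup p w)) * word_act f w g)"

lemma gen_act_add: "gen_act f t (g + h) = gen_act f t g + gen_act f t h"
  by (cases t) (simp_all add: fdiff_add algebra_simps add_divide_distrib)

lemma gen_act_const:
  "gen_act f t (mfract_of (monomial 0 c) * g) = mfract_of (monomial 0 c) * gen_act f t g"
  by (cases t) (simp_all add: fdiff_mult algebra_simps)

lemma gen_act_s: "gen_act f t (s_mfract * g) = s_mfract * gen_act f t g"
  by (cases t) (simp_all add: fdiff_mult algebra_simps)

lemma word_act_add: "word_act f w (g + h) = word_act f w g + word_act f w h"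
proof -
  have "foldr (gen_act f) ts (g + h) = foldr (gen_act f) ts g + foldr (gen_act f) ts h" for ts
    by (induction ts) (simp_all add: gen_act_add)
  then show ?thesis by (simp add: word_act_def)
qed

lemma word_act_const:
  "word_act f w (mfract_of (monomial 0 c) * g) = mfract_of (monomial 0 c) * word_act f w g"
proof -
  have "foldr (gen_act f) ts (mfract_of (monomial 0 c) * g)
      = mfract_of (monomial 0 c) * foldr (gen_act f) ts g" for ts
    by (induction ts) (simp_all add: gen_act_const)
  then show ?thesis by (simp add: word_act_def)
qed

lemma word_act_s: "word_act f w (s_mfract * g) = s_mfract * word_act f w g"
proof -
  have "foldr (gen_act f) ts (s_mfract * g) = s_mfract * foldr (gen_act f) ts g" for ts
    by (induction ts) (simp_all add: gen_act_s)
  then show ?thesis by (simp add: word_act_def)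
qed

lemma word_act_plus: "word_act f (u + v) g = word_act f u (word_act f v g)"
  by (simp add: word_act_def plus_fword_def)

lemma word_act_zero [simp]: "word_act f 0 g = g"
  by (simp add: word_act_def zero_fword_def)

lemma free_act_single [simp]:
  "free_act f (monomial w c) g = mfract_of (monomial 0 c) * word_act f w g"
  unfolding free_act_def
  by (rule keys_sum_single[where g = "\<lambda>w c. mfract_of (monomial 0 c) * word_act f w g"]) simp

lemma free_act_add [simp]: "free_act f (p + q) g = free_act f p g + free_act f q g"
  unfolding free_act_def
  by (rule keys_sum_add[where g = "\<lambda>w c. mfract_of (monomial 0 c) * word_act f w g"])
     (simp_all add: algebra_simps single_add mfract_of_add)

lemma free_act_0 [simp]: "free_act f 0 g = 0"
  by (simp add: free_act_def)

lemma free_act_uminus [simp]: "free_act f (- p) g = - free_act f p g"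
  using free_act_add[of f p "- p" g] by (simp add: eq_neg_iff_add_eq_0 add.commute del: free_act_add)

lemma free_act_diff [simp]: "free_act f (p - q) g = free_act f p g - free_act f q g"
  using free_act_add[of f p "- q" g] by simp

lemma free_act_1 [simp]: "free_act f 1 g = g"
  using free_act_single[of f 0 1 g] by simp

lemma free_act_arg_add: "free_act f p (g + h) = free_act f p g + free_act f p h"
  by (simp add: free_act_def word_act_add algebra_simps sum.distrib)

lemma free_act_arg_0 [simp]: "free_act f p 0 = 0"
  by (metis add.right_neutral add_left_imp_eq free_act_arg_add)

lemma free_act_s: "free_act f p (s_mfract * g) = s_mfract * free_act f p g"
  by (simp add: free_act_def word_act_s sum_distrib_left algebra_simps)

lemma free_act_mult: "free_act f (p * q) g = free_act f p (free_act f q g)"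
proof (induction p rule: poly_mapping_add_induct)
  case (single u c)
  show ?case
  proof (induction q rule: poly_mapping_add_induct)
    case (single v d)
    have "mfract_of (monomial 0 (c * d) :: ('a, 'b) mpoly)
            = mfract_of (monomial 0 c) * mfract_of (monomial 0 d)"
      by (simp add: mult_single flip: mfract_of_mult)
    then show ?case by (simp add: mult_single word_act_plus word_act_const)
  qed (simp add: algebra_simps free_act_arg_add word_act_add)
qed (simp add: algebra_simps)

lemma free_act_relations: "p \<in> weyl_relations \<Longrightarrow> free_act f p g = 0"
proof -
  have x: "free_act f (free_x i) g = gen_act f (Gen_X i) g" for i g
    by (simp add: free_x_def word_act_def)
  have d: "free_act f (free_d i) g = gen_act f (Gen_D i) g" for i g
    by (simp add: free_d_def word_act_def)
  have pd: "fdiff i (mfract_of (monomial (monomial j 1) 1)) = (if i = j then 1 else 0)" for i j :: 'a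
    by (auto simp: fdiff_mfract_of lookup_single)
  have dd: "gen_act f (Gen_D j) (gen_act f (Gen_D i) g)
      = gen_act f (Gen_D i) (gen_act f (Gen_D j) g)" for i j
  proof -
    show ?thesis
      by (simp add: fdiff_add fdiff_mult fdiff_commute_quot[of j i] fdiff_commute[of j i] algebra_simps
               del: times_divide_eq_right times_divide_eq_left)
  qed
  assume "p \<in> weyl_relations"
  then consider
      i j where "p = free_d i * free_x j - free_x j * free_d i - (if i = j then 1 else 0)"
    | i j where "p = free_x j * free_x i - free_x i * free_x j"
    | i j where "p = free_d j * free_d i - free_d i * free_d j"
    unfolding weyl_relations_def by blast
  then show ?thesis
  proof cases
    case 1
    show ?thesis unfolding 1
      by (cases "i = j"; simp add: free_act_mult x d pd fdiff_mult del: One_nat_def; simp add: algebra_simps)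
  next
    case 2
    show ?thesis unfolding 2 by (simp add: free_act_mult x mult_ac)
  next
    case 3
    show ?thesis unfolding 3 by (simp add: free_act_mult d dd del: gen_act.simps)
  qed
qed

lemma free_act_ideal:
  assumes "p \<in> two_sided_ideal hull weyl_relations"
  shows "free_act f p g = 0"
proof -
  have "two_sided_ideal {p. \<forall>g. free_act f p g = 0}"
    by (auto simp: two_sided_ideal_def left_ideal_def free_act_mult)
  then have "two_sided_ideal hull weyl_relations \<subseteq> {p. \<forall>g. free_act f p g = 0}"
    by (intro hull_minimal) (auto simp: free_act_relations)
  then show ?thesis using assms by auto
qed

subsection \<open>Ring structure\<close>

instantiation weyl :: (linorder, field) ring_1
begin

lift_definition zero_weyl :: "('a, 'b) weyl" is 0 .
lift_definition one_weyl :: "('a, 'b) weyl" is 1 .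

lift_definition plus_weyl :: "('a, 'b) weyl \<Rightarrow> ('a, 'b) weyl \<Rightarrow> ('a, 'b) weyl" is "(+)"
  unfolding weyl_eq_def by (metis add_diff_add two_sided_ideal_add two_sided_ideal_hull)

lift_definition uminus_weyl :: "('a, 'b) weyl \<Rightarrow> ('a, 'b) weyl" is uminus
  unfolding weyl_eq_def
  by (metis minus_diff_minus two_sided_ideal_hull two_sided_ideal_uminus)

lift_definition minus_weyl :: "('a, 'b) weyl \<Rightarrow> ('a, 'b) weyl \<Rightarrow> ('a, 'b) weyl" is "(-)"
proof -
  fix p p' q q' :: "('a, 'b) weyl_free"
  note I = two_sided_ideal_hull[of weyl_relations]
  assume "weyl_eq p p'" "weyl_eq q q'"
  then have "(p - p') + - (q - q') \<in> two_sided_ideal hull weyl_relations"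
    unfolding weyl_eq_def by (intro two_sided_ideal_add[OF I] two_sided_ideal_uminus[OF I])
  then show "weyl_eq (p - q) (p' - q')" by (simp add: weyl_eq_def algebra_simps)
qed

lift_definition times_weyl :: "('a, 'b) weyl \<Rightarrow> ('a, 'b) weyl \<Rightarrow> ('a, 'b) weyl" is "(*)"
proof -
  fix p p' q q' :: "('a, 'b) weyl_free"
  note I = two_sided_ideal_hull[of weyl_relations]
  assume "weyl_eq p p'" "weyl_eq q q'"
  then have "(p - p') * q + p' * (q - q') \<in> two_sided_ideal hull weyl_relations"
    unfolding weyl_eq_def
    by (intro two_sided_ideal_add[OF I] two_sided_ideal_lmult[OF I] two_sided_ideal_rmult[OF I])
  then show "weyl_eq (p * q) (p' * q')" by (simp add: weyl_eq_def algebra_simps)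
qed

instance
proof
  have "\<not> weyl_eq (0 :: ('a, 'b) weyl_free) 1"
    using free_act_ideal[of "0 - 1 :: ('a, 'b) weyl_free" 1 1] by (auto simp: weyl_eq_def)
  then show "(0 :: ('a, 'b) weyl) \<noteq> 1" by transfer
qed (transfer; simp add: equivp_reflp[OF equivp_weyl_eq] algebra_simps)+

end

lift_definition weyl_x :: "'n \<Rightarrow> ('n, 'k::field) weyl" is free_x .

lift_definition weyl_d :: "'n \<Rightarrow> ('n, 'k::field) weyl" is free_d .

lift_definition weyl_const :: "'k \<Rightarrow> ('n, 'k::field) weyl" is "monomial 0" .

text \<open>The variables commute, so the order of the factors below is immaterial.\<close>

definition weyl_of_mpoly :: "('n::{finite, linorder}, 'k::field) mpoly \<Rightarrow> ('n, 'k) weyl" where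
  "weyl_of_mpoly g = (\<Sum>a\<in>keys g. weyl_const (lookup g a) *
     prod_list (map (\<lambda>i. weyl_x i ^ lookup a i) (sorted_list_of_set UNIV)))"

lift_definition weyl_act ::
  "('n::linorder, 'k::field) mpoly \<Rightarrow> ('n, 'k) weyl \<Rightarrow> ('n, 'k) mfract \<Rightarrow> ('n, 'k) mfract"
  is free_act
proof -
  fix f :: "('n, 'k) mpoly" and p q :: "('n, 'k) weyl_free"
  assume "weyl_eq p q"
  then show "free_act f p = free_act f q"
    using free_act_ideal[of "p - q" f] by (auto simp: weyl_eq_def)
qed

lemma weyl_act_mult: "weyl_act f (P * Q) g = weyl_act f P (weyl_act f Q g)"
  by transfer (rule free_act_mult)

lemma weyl_act_add: "weyl_act f (P + Q) g = weyl_act f P g + weyl_act f Q g"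
  by transfer simp

lemma weyl_act_0 [simp]: "weyl_act f 0 g = 0"
  by transfer simp

lemma weyl_act_1 [simp]: "weyl_act f 1 g = g"
  by transfer simp

lemma weyl_act_arg_add: "weyl_act f P (g + h) = weyl_act f P g + weyl_act f P h"
  by transfer (rule free_act_arg_add)

lemma weyl_act_const: "weyl_act f (weyl_const c) g = mfract_of (monomial 0 c) * g"
  by transfer simp

lemma weyl_act_x: "weyl_act f (weyl_x i) g = mfract_of (monomial (monomial i 1) 1) * g"
  by transfer (simp add: free_x_def word_act_def)

lemma weyl_act_d:
  "weyl_act f (weyl_d i) g = fdiff i g + s_mfract * g * (mfract_of (pdiff i f) / mfract_of f)"
  by transfer (simp add: free_d_def word_act_def)

lemma weyl_act_s: "weyl_act f P (s_mfract ^ j * g) = s_mfract ^ j * weyl_act f P g"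
proof -
  have "weyl_act f P (s_mfract * g) = s_mfract * weyl_act f P g" for g
    by transfer (rule free_act_s)
  then show ?thesis by (induction j) (simp_all add: mult.assoc)
qed

lemma weyl_act_sum: "weyl_act f (sum P A) g = (\<Sum>x\<in>A. weyl_act f (P x) g)"
  by (induction A rule: infinite_finite_induct) (simp_all add: weyl_act_add)

lemma monomial_eq_prod:
  "(\<Prod>i\<in>UNIV. monomial (monomial i 1) 1 ^ lookup a i)
     = (monomial a 1 :: ('n::{finite, linorder}, 'k::field) mpoly)"
proof -
  have "(\<Prod>i\<in>A. monomial (monomial i 1) 1 ^ e i) = (monomial (\<Sum>i\<in>A. monomial i (e i)) 1
    :: ('n, 'k) mpoly)" if "finite A" for A and e :: "'n \<Rightarrow> nat"
    using that
  proof (induction A rule: finite_induct)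
    case (insert i A)
    have "monomial (monomial i 1) 1 ^ m = (monomial (monomial i m) 1 :: ('n, 'k) mpoly)" for m
      by (induction m) (simp_all add: mult_single flip: single_add)
    then show ?case using insert by (simp add: mult_single)
  qed simp
  moreover have "(\<Sum>i\<in>UNIV. monomial i (lookup a i)) = a"
    by (intro poly_mapping_eqI) (simp add: lookup_sum lookup_single when_def)
  ultimately show ?thesis by simp
qed

lemma weyl_act_of_mpoly: "weyl_act f (weyl_of_mpoly g) h = mfract_of g * h"
proof -
  have pow: "weyl_act f (weyl_x i ^ m) h = mfract_of (monomial (monomial i 1) 1 ^ m) * h" for i m h
    by (induction m arbitrary: h) (simp_all add: weyl_act_mult weyl_act_x mfract_of_mult mult_ac)
  have "weyl_act f (prod_list (map (\<lambda>i. weyl_x i ^ e i) is)) h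
      = mfract_of (prod_list (map (\<lambda>i. monomial (monomial i 1) 1 ^ e i) is)) * h" for e "is" h
    by (induction "is" arbitrary: h) (simp_all add: weyl_act_mult pow mfract_of_mult mult_ac)
  moreover have "prod_list (map (\<lambda>i. monomial (monomial i 1) 1 ^ lookup a i) (sorted_list_of_set UNIV))
      = (monomial a 1 :: ('a, 'b) mpoly)" for a
    by (simp add: monomial_eq_prod del: One_nat_def flip: prod.distinct_set_conv_list)
  ultimately have "weyl_act f (weyl_of_mpoly g) h
      = (\<Sum>a\<in>keys g. mfract_of (monomial 0 (lookup g a)) * (mfract_of (monomial a 1) * h))"
    by (simp add: weyl_of_mpoly_def weyl_act_sum weyl_act_mult weyl_act_const)
  also have "\<dots> = (\<Sum>a\<in>keys g. mfract_of (monomial a (lookup g a))) * h"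
    by (simp add: sum_distrib_right mult_single flip: mfract_of_mult mult.assoc)
  also have "(\<Sum>a\<in>A. mfract_of (u a)) = mfract_of (\<Sum>a\<in>A. u a)"
    for A and u :: "_ \<Rightarrow> ('a, 'b) mpoly"
    by (induction A rule: infinite_finite_induct) (simp_all add: mfract_of_add)
  also have "(\<Sum>a\<in>keys g. monomial a (lookup g a)) = g"
    by (intro poly_mapping_eqI) (auto simp: lookup_sum lookup_single when_def in_keys_iff)
  finally show ?thesis .
qed

section \<open>The ring \<open>D\<^sub>n[s]\<close>\<close>

text \<open>
  \<open>D\<^sub>n[s]\<close> is the monoid algebra over \<open>D\<^sub>n\<close> of the additive monoid \<open>nat\<close>: an element is the
  finitely supported sequence of its coefficients, and the variable \<open>s\<close> is central.
\<close>

type_synonym ('n, 'k) weyl_s = "nat \<Rightarrow>\<^sub>0 ('n, 'k) weyl"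

definition weyl_s_of_mpoly :: "('n::{finite, linorder}, 'k::field) mpoly \<Rightarrow> ('n, 'k) weyl_s" where
  "weyl_s_of_mpoly g = monomial 0 (weyl_of_mpoly g)"

definition weyl_s_of_poly :: "'k poly \<Rightarrow> ('n::linorder, 'k::field) weyl_s" where
  "weyl_s_of_poly b = (\<Sum>j\<le>degree b. monomial j (weyl_const (coeff b j)))"

definition subst_s :: "'k \<Rightarrow> ('n::linorder, 'k::field) weyl_s \<Rightarrow> ('n, 'k) weyl" where
  "subst_s c P = (\<Sum>j\<in>keys P. lookup P j * weyl_const (c ^ j))"

definition weyl_s_act ::
  "('n::linorder, 'k::field) mpoly \<Rightarrow> ('n, 'k) weyl_s \<Rightarrow> ('n, 'k) mfract \<Rightarrow> ('n, 'k) mfract" where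
  "weyl_s_act f P g = (\<Sum>j\<in>keys P. s_mfract ^ j * weyl_act f (lookup P j) g)"

lemma weyl_s_act_monomial [simp]:
  "weyl_s_act f (monomial j P) g = s_mfract ^ j * weyl_act f P g"
  unfolding weyl_s_act_def
  by (rule keys_sum_single[where g = "\<lambda>j P. s_mfract ^ j * weyl_act f P g"]) simp

lemma weyl_s_act_add: "weyl_s_act f (P + Q) g = weyl_s_act f P g + weyl_s_act f Q g"
  unfolding weyl_s_act_def
  by (rule keys_sum_add[where g = "\<lambda>j P. s_mfract ^ j * weyl_act f P g"])
     (simp_all add: algebra_simps weyl_act_add)

lemma weyl_s_act_arg_add: "weyl_s_act f P (g + h) = weyl_s_act f P g + weyl_s_act f P h"
  by (simp add: weyl_s_act_def weyl_act_arg_add algebra_simps sum.distrib)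

lemma weyl_s_act_1: "weyl_s_act f 1 g = g"
  using weyl_s_act_monomial[of f 0 1 g] by simp

lemma weyl_s_act_mult: "weyl_s_act f (P * Q) g = weyl_s_act f P (weyl_s_act f Q g)"
proof (induction P rule: poly_mapping_add_induct)
  case (single i A)
  show ?case
    by (induction Q rule: poly_mapping_add_induct)
       (simp_all add: mult_single weyl_act_mult weyl_act_s power_add mult.assoc
         distrib_left weyl_s_act_add weyl_act_arg_add)
qed (simp add: distrib_right weyl_s_act_add)

lemma weyl_s_act_uminus: "weyl_s_act f (- P) g = - weyl_s_act f P g"
proof -
  have "weyl_s_act f (- P) g + weyl_s_act f P g = weyl_s_act f (- P + P) g"
    by (simp only: weyl_s_act_add)
  then show ?thesis by (simp add: weyl_s_act_def eq_neg_iff_add_eq_0)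
qed

definition ann_f_power_s :: "('n::linorder, 'k::field) mpoly \<Rightarrow> ('n, 'k) weyl_s set" where
  "ann_f_power_s f = {P. weyl_s_act f P f_power_s = 0}"

lemma left_ideal_ann_f_power_s: "left_ideal (ann_f_power_s f)"
proof -
  have 0: "weyl_s_act f P 0 = 0" for P
    using weyl_s_act_arg_add[of f P 0 0] by (metis add.right_neutral add_left_imp_eq)
  show ?thesis
    by (auto simp: left_ideal_def ann_f_power_s_def weyl_s_act_add weyl_s_act_mult 0)
       (simp add: weyl_s_act_def)
qed

lemma localization_closed:
  assumes "f \<noteq> 0"
  shows localization_to_fract: "to_fract g \<in> localization f"
    and localization_add: "x \<in> localization f \<Longrightarrow> y \<in> localization f \<Longrightarrow> x + y \<in> localization f"
    and localization_mult: "x \<in> localization f \<Longrightarrow> y \<in> localization f \<Longrightarrow> x * y \<in> localization f"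
    and localization_divide: "x \<in> localization f \<Longrightarrow> x / mfract_of f ^ k \<in> localization f"
proof -
  let ?F = "mfract_of f"
  have F: "?F \<noteq> 0" "?F = to_fract [:f:]" using assms by (simp, simp add: mfract_of_def)
  have pow: "to_fract p ^ k = to_fract (p ^ k)" for p :: "('a, 'b) mpoly poly" and k
    by (induction k) simp_all
  have I: "to_fract g / ?F ^ m \<in> localization f" for g m
    unfolding localization_def by blast
  show "to_fract g \<in> localization f" using I[of g 0] by simp
  show "x + y \<in> localization f" if xy: "x \<in> localization f" "y \<in> localization f"
  proof -
    obtain g h k m where "x = to_fract g / ?F ^ k" "y = to_fract h / ?F ^ m"
      using xy unfolding localization_def by blast
    then have "x + y = (to_fract g * ?F ^ m + to_fract h * ?F ^ k) / ?F ^ (k + m)"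
      using F(1) by (simp add: add_frac_eq power_add)
    also have "\<dots> = to_fract (g * [:f:] ^ m + h * [:f:] ^ k) / ?F ^ (k + m)"
      by (simp add: F(2) pow)
    finally have "x + y = to_fract (g * [:f:] ^ m + h * [:f:] ^ k) / ?F ^ (k + m)" .
    then show ?thesis using I by metis
  qed
  show "x * y \<in> localization f" if xy: "x \<in> localization f" "y \<in> localization f"
  proof -
    obtain g h k m where "x = to_fract g / ?F ^ k" "y = to_fract h / ?F ^ m"
      using xy unfolding localization_def by blast
    then have "x * y = to_fract (g * h) / ?F ^ (k + m)"
      by (simp add: power_add)
    then show ?thesis using I by metis
  qed
  show "x / ?F ^ k \<in> localization f" if x: "x \<in> localization f"
  proof -
    obtain g m where "x = to_fract g / ?F ^ m"
      using x unfolding localization_def by blast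
    then have "x / ?F ^ k = to_fract g / ?F ^ (m + k)"
      by (simp add: power_add)
    then show ?thesis using I by simp
  qed
qed

lemma fdiff_localization:
  assumes "f \<noteq> 0" "x \<in> localization f"
  shows "fdiff i x \<in> localization f"
proof -
  let ?F = "mfract_of f"
  obtain g m where x: "x = to_fract g / ?F ^ m"
    using assms unfolding localization_def by blast
  have pow: "?F ^ m = to_fract ([:f:] ^ m)"
    by (induction m) (simp_all add: mfract_of_def flip: to_fract_mult)
  have F: "?F ^ m \<noteq> 0" using assms by simp
  let ?h = "map_poly (pdiff i) ([:f:] ^ m)"
  have "x * ?F ^ m = to_fract g" using F x by simp
  then have "fdiff i (x * ?F ^ m) = to_fract (map_poly (pdiff i) g)"
    by (simp add: fdiff_to_fract)
  then have "fdiff i x * ?F ^ m = to_fract (map_poly (pdiff i) g) + x * to_fract (- ?h)"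
    by (simp add: fdiff_mult fdiff_to_fract pow algebra_simps)
  then have "fdiff i x = (to_fract (map_poly (pdiff i) g) + x * to_fract (- ?h)) / ?F ^ m"
    using F by (simp add: eq_divide_eq)
  also have "\<dots> \<in> localization f"
    by (intro localization_closed assms)
  finally show ?thesis .
qed

text \<open>\<open>M\<close> is a \<open>D\<^sub>n[s]\<close>-submodule of the field of fractions.\<close>

lemma f_power_s_in_localization: "f \<noteq> 0 \<Longrightarrow> f_power_s \<in> localization f"
  using localization_to_fract[of f 1] by (simp add: f_power_s_def)

lemma weyl_s_act_localization:
  assumes f: "f \<noteq> 0" and g: "g \<in> localization f"
  shows "weyl_s_act f P g \<in> localization f"
proof -
  have m: "mfract_of h \<in> localization f" for h
    unfolding mfract_of_def by (rule localization_to_fract[OF f])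
  have 0: "0 \<in> localization f"
    using m[of 0] by simp
  have s: "s_mfract \<in> localization f"
    unfolding s_mfract_def by (rule localization_to_fract[OF f])
  have gen: "gen_act f t h \<in> localization f" if "h \<in> localization f" for t h
  proof (cases t)
    case (Gen_X i)
    then show ?thesis by (simp add: localization_mult[OF f] m that)
  next
    case (Gen_D i)
    have "mfract_of (pdiff i f) / mfract_of f ^ 1 \<in> localization f"
      by (intro localization_closed f m)
    then show ?thesis unfolding Gen_D gen_act.simps
      by (intro localization_add localization_mult fdiff_localization f that s) simp
  qed
  have word: "foldr (gen_act f) ts h \<in> localization f" if "h \<in> localization f" for ts h
    by (induction ts) (simp_all add: gen that)
  have sum: "(\<Sum>x\<in>A. u x) \<in> localization f" if "\<And>x. u x \<in> localization f" for A and u :: "'c \<Rightarrow> _"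
    by (induction A rule: infinite_finite_induct) (simp_all add: 0 localization_add[OF f] that)
  have free: "free_act f p h \<in> localization f" if "h \<in> localization f" for p h
    unfolding free_act_def word_act_def
    by (intro sum) (simp add: localization_mult[OF f] m word that)
  have weyl: "weyl_act f Q h \<in> localization f" if "h \<in> localization f" for Q h
    using that by (induction Q rule: weyl.abs_induct) (simp add: weyl_act.abs_eq free)
  have "s_mfract ^ j \<in> localization f" for j
    by (induction j) (use localization_to_fract[OF f, of 1] in \<open>simp_all add: localization_mult[OF f] s\<close>)
  then show ?thesis
    unfolding weyl_s_act_def
    by (intro sum localization_mult[OF f] weyl g)
qed

section \<open>The Bernstein--Sato polynomial\<close>

definition has_functional_equation ::
  "('n::{finite, linorder}, 'k::field) mpoly \<Rightarrow> 'k poly \<Rightarrow> bool" where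
  "has_functional_equation f b \<longleftrightarrow>
     (\<exists>P. weyl_s_act f (P * weyl_s_of_mpoly f) f_power_s = weyl_s_act f (weyl_s_of_poly b) f_power_s)"

definition is_bernstein_sato_poly ::
  "('n::{finite, linorder}, 'k::field) mpoly \<Rightarrow> 'k poly \<Rightarrow> bool" where
  "is_bernstein_sato_poly f b \<longleftrightarrow>
     lead_coeff b = 1 \<and> has_functional_equation f b \<and>
     (\<forall>c. lead_coeff c = 1 \<and> has_functional_equation f c \<longrightarrow> degree b \<le> degree c)"

lemma lookup_weyl_s_of_poly: "lookup (weyl_s_of_poly b) j = weyl_const (coeff b j)"
proof -
  have "weyl_const 0 = (0 :: ('a, 'b) weyl)" by transfer (simp add: equivp_reflp[OF equivp_weyl_eq])
  then show ?thesis
    by (auto simp: weyl_s_of_poly_def lookup_sum lookup_single when_def coeff_eq_0)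
qed

lemma weyl_s_of_poly_diff: "weyl_s_of_poly (b - c) = weyl_s_of_poly b - weyl_s_of_poly c"
proof -
  have "weyl_const (u - v) = (weyl_const u - weyl_const v :: ('a, 'b) weyl)" for u v
    by transfer (simp add: single_diff equivp_reflp[OF equivp_weyl_eq])
  then show ?thesis by (intro poly_mapping_eqI) (simp add: lookup_weyl_s_of_poly lookup_minus)
qed

lemma weyl_s_of_poly_smult:
  "weyl_s_of_poly (smult c b) = monomial 0 (weyl_const c) * weyl_s_of_poly b"
proof -
  have *: "weyl_const (u * v) = (weyl_const u * weyl_const v :: ('a, 'b) weyl)" for u v
    by transfer (simp add: mult_single equivp_reflp[OF equivp_weyl_eq])
  have "monomial 0 a * Q = Poly_Mapping.map ((*) a) Q" for a and Q :: "('a, 'b) weyl_s"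
    by (simp add: mult_map_scale_conv_mult)
  then show ?thesis
    by (intro poly_mapping_eqI)
       (simp add: lookup_weyl_s_of_poly * Poly_Mapping.map.rep_eq when_def)
qed

text \<open>There is at most one such polynomial.\<close>

lemma is_bernstein_sato_poly_unique:
  assumes b: "is_bernstein_sato_poly f b" and c: "is_bernstein_sato_poly f c"
  shows "b = c"
proof (rule ccontr)
  assume "b \<noteq> c"
  define d where "d = b - c"
  have "d \<noteq> 0" using \<open>b \<noteq> c\<close> by (simp add: d_def)
  have deg: "degree b = degree c"
    using b c by (intro antisym) (auto simp: is_bernstein_sato_poly_def)
  have lc: "lead_coeff b = 1" "lead_coeff c = 1"
    using b c by (auto simp: is_bernstein_sato_poly_def)
  have "coeff d (degree b) = 0" "degree d \<le> degree b"
    using lc deg by (simp_all add: d_def degree_diff_le)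
  with \<open>d \<noteq> 0\<close> have less: "degree d < degree b"
    by (metis leading_coeff_0_iff le_neq_implies_less)
  obtain P Q where
    P: "weyl_s_act f (P * weyl_s_of_mpoly f) f_power_s = weyl_s_act f (weyl_s_of_poly b) f_power_s" and
    Q: "weyl_s_act f (Q * weyl_s_of_mpoly f) f_power_s = weyl_s_act f (weyl_s_of_poly c) f_power_s"
    using b c by (auto simp: is_bernstein_sato_poly_def has_functional_equation_def)
  have diff: "weyl_s_act f (U - V) g = weyl_s_act f U g - weyl_s_act f V g" for U V g
    using weyl_s_act_add[of f U "- V" g] by (simp add: weyl_s_act_uminus)
  let ?a = "monomial 0 (weyl_const (inverse (lead_coeff d))) :: ('a, 'b) weyl_s"
  have "weyl_s_act f ((?a * (P - Q)) * weyl_s_of_mpoly f) f_power_s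
      = weyl_s_act f (weyl_s_of_poly (smult (inverse (lead_coeff d)) d)) f_power_s"
    unfolding weyl_s_of_poly_smult mult.assoc weyl_s_act_mult[of f ?a]
    by (simp only: d_def weyl_s_of_poly_diff left_diff_distrib diff P Q)
  then have "has_functional_equation f (smult (inverse (lead_coeff d)) d)"
    unfolding has_functional_equation_def by blast
  moreover have "lead_coeff (smult (inverse (lead_coeff d)) d) = 1"
    using \<open>d \<noteq> 0\<close> by simp
  ultimately have "degree b \<le> degree (smult (inverse (lead_coeff d)) d)"
    using b unfolding is_bernstein_sato_poly_def by blast
  then show False using less \<open>d \<noteq> 0\<close> by simp
qed

end

theory Submission
  imports Defs
begin

text \<open>
  Put \<open>J = Ann(f\<^sup>s) + D\<^sub>n[s] f\<close> and \<open>I = J + D\<^sub>n[s] (s + \<alpha>)\<close>; the latter is the ideal in (2).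
  The elements \<open>c\<close> of \<open>\<bbbK>[s]\<close> lying in \<open>J\<close> are exactly those that admit a functional equation
  (\<open>has_functional_equation_iff\<close>). Everything rests on division with remainder by \<open>s + \<alpha>\<close> in
  \<open>\<bbbK>[s]\<close>, which is central in \<open>D\<^sub>n[s]\<close>.

  If \<open>p \<in> I\<close> is a polynomial in \<open>s\<close> with \<open>p(-\<alpha>) \<noteq> 0\<close>, then the non-zero scalar \<open>p(-\<alpha>)\<close> lies in
  \<open>I\<close>, so \<open>I\<close> is everything (\<open>left_ideal_UNIV_if_poly_nonzero\<close>). With \<open>p = b\<^sub>f\<close> this gives
  (2) \<open>\<Rightarrow>\<close> (1), and it gives the final assertion: if \<open>I\<close> is proper, a polynomial in \<open>I\<close> vanishes
  at \<open>-\<alpha>\<close> and is therefore a multiple of \<open>s + \<alpha>\<close>.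

  For (1) \<open>\<Rightarrow>\<close> (2), let \<open>b\<^sub>f = c (s + \<alpha>)\<close> and suppose that \<open>1 = j + q (s + \<alpha>)\<close> with \<open>j \<in> J\<close>.
  Multiplying by \<open>c\<close> gives \<open>c = c j + q b\<^sub>f \<in> J\<close> because \<open>c\<close> is central, so \<open>c\<close> satisfies a
  functional equation although its degree is smaller than that of \<open>b\<^sub>f\<close>
  (\<open>one_notin_if_bernstein_sato_root\<close>).

  The equivalence of (2) and (3) expresses that \<open>s \<mapsto> -\<alpha>\<close> induces an isomorphism
  \<open>D\<^sub>n[s] / D\<^sub>n[s] (s + \<alpha>) \<cong> D\<^sub>n\<close>: the substitution is multiplicative (\<open>subst_s_mult\<close>), and \<open>P(s)\<close>
  is congruent to \<open>P(-\<alpha>)\<close> modulo \<open>s + \<alpha>\<close> (\<open>subst_s_cong\<close>).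
\<close>

section \<open>Generated left ideals\<close>

lemma left_ideal_diff: "left_ideal I \<Longrightarrow> a \<in> I \<Longrightarrow> b \<in> I \<Longrightarrow> a - b \<in> I"
  using left_ideal_def[of I] by (metis add_uminus_conv_diff mult_minus1)

lemma left_ideal_eq_UNIV_iff: "left_ideal I \<Longrightarrow> I = UNIV \<longleftrightarrow> 1 \<in> I"
  unfolding left_ideal_def by (metis UNIV_eq_I UNIV_I mult.right_neutral)

lemma left_ideal_gen_superset: "S \<subseteq> left_ideal_gen S"
  unfolding left_ideal_gen_def by (rule hull_subset)

lemma left_ideal_gen_minimal: "S \<subseteq> I \<Longrightarrow> left_ideal I \<Longrightarrow> left_ideal_gen S \<subseteq> I"
  unfolding left_ideal_gen_def by (rule hull_minimal)

lemma left_ideal_gen_insert: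
  "left_ideal_gen (insert x S) = {a + q * x | a q. a \<in> left_ideal_gen S}"
proof
  let ?I = "{a + q * x | a q. a \<in> left_ideal_gen S}"
  note S = left_ideal_left_ideal_gen[of S, unfolded left_ideal_def]
  have mem: "a + q * x \<in> ?I" if "a \<in> left_ideal_gen S" for a q
    using that by blast
  show "left_ideal_gen (insert x S) \<subseteq> ?I"
  proof (rule left_ideal_gen_minimal)
    show "insert x S \<subseteq> ?I"
      using mem[of _ 0] mem[of 0 1] left_ideal_gen_superset[of S] S by auto
    show "left_ideal ?I"
      unfolding left_ideal_def
    proof (intro conjI ballI allI)
      show "0 \<in> ?I" using mem[of 0 0] S by simp
    next
      fix u v assume "u \<in> ?I" "v \<in> ?I"
      then obtain a q a' q' where "u = a + q * x" "v = a' + q' * x"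
        "a \<in> left_ideal_gen S" "a' \<in> left_ideal_gen S" by blast
      then show "u + v \<in> ?I"
        using mem[of "a + a'" "q + q'"] S by (simp add: algebra_simps)
    next
      fix r u assume "u \<in> ?I"
      then obtain a q where "u = a + q * x" "a \<in> left_ideal_gen S" by blast
      then show "r * u \<in> ?I"
        using mem[of "r * a" "r * q"] S by (simp add: algebra_simps)
    qed
  qed
  have "x \<in> left_ideal_gen (insert x S)" and "left_ideal_gen S \<subseteq> left_ideal_gen (insert x S)"
    using left_ideal_gen_superset[of "insert x S"]
    by (auto intro!: left_ideal_gen_minimal left_ideal_left_ideal_gen del: subsetI)
  then show "?I \<subseteq> left_ideal_gen (insert x S)"
    using left_ideal_left_ideal_gen[of "insert x S"] unfolding left_ideal_def by blast
qed

lemma left_ideal_gen_singleton: "left_ideal_gen {x} = range (\<lambda>q. q * x)"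
proof -
  have "left_ideal_gen {} = {0 :: 'a}"
    using left_ideal_gen_minimal[of "{}" "{0 :: 'a}"] left_ideal_left_ideal_gen[of "{} :: 'a set"]
    by (auto simp: left_ideal_def)
  then show ?thesis by (auto simp: left_ideal_gen_insert)
qed

section \<open>Polynomials in \<open>s\<close> are central in \<open>D\<^sub>n[s]\<close>\<close>

lemma weyl_const_0 [simp]: "weyl_const 0 = (0 :: ('n::linorder, 'k::field) weyl)"
  by transfer (simp add: equivp_reflp[OF equivp_weyl_eq])

lemma weyl_const_1 [simp]: "weyl_const 1 = (1 :: ('n::linorder, 'k::field) weyl)"
  by transfer (simp add: equivp_reflp[OF equivp_weyl_eq])

lemma weyl_const_add:
  "weyl_const (c + d) = (weyl_const c + weyl_const d :: ('n::linorder, 'k::field) weyl)"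
  by transfer (simp add: single_add equivp_reflp[OF equivp_weyl_eq])

lemma weyl_const_mult:
  "weyl_const (c * d) = (weyl_const c * weyl_const d :: ('n::linorder, 'k::field) weyl)"
  by transfer (simp add: mult_single equivp_reflp[OF equivp_weyl_eq])

lemma weyl_const_central:
  "weyl_const c * A = A * (weyl_const c :: ('n::linorder, 'k::field) weyl)"
proof transfer
  fix c and p :: "('n, 'k) weyl_free"
  have "monomial 0 c * p = p * monomial 0 c"
    by (induction p rule: poly_mapping_add_induct) (simp_all add: mult_single algebra_simps)
  then show "weyl_eq (monomial 0 c * p) (p * monomial 0 c)"
    by (simp add: equivp_reflp[OF equivp_weyl_eq])
qed

lemma weyl_s_of_poly_1 [simp]: "weyl_s_of_poly 1 = 1"
  by (simp add: weyl_s_of_poly_def)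

lemma weyl_s_of_poly_add: "weyl_s_of_poly (b + c) = weyl_s_of_poly b + weyl_s_of_poly c"
  by (intro poly_mapping_eqI) (simp add: lookup_weyl_s_of_poly lookup_add weyl_const_add)

lemma weyl_s_of_poly_monom: "weyl_s_of_poly (Polynomial.monom c j) = monomial j (weyl_const c)"
  by (intro poly_mapping_eqI) (simp add: lookup_weyl_s_of_poly lookup_single when_def)

lemma poly_monom_induct [case_names monom add]:
  assumes "\<And>c j. Q (Polynomial.monom c j)" and "\<And>p q. Q p \<Longrightarrow> Q q \<Longrightarrow> Q (p + q)"
  shows "Q (p :: 'a::comm_monoid_add poly)"
proof -
  have "Q (\<Sum>i\<in>A. Polynomial.monom (coeff p i) i)" for A :: "nat set"
    by (induction A rule: infinite_finite_induct)
       (use assms(1)[of 0 0] in \<open>simp_all add: assms\<close>)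
  then show ?thesis by (metis poly_as_sum_of_monoms)
qed

lemma weyl_s_of_poly_mult:
  "weyl_s_of_poly (b * c) = (weyl_s_of_poly b * weyl_s_of_poly c :: ('n::linorder, 'k::field) weyl_s)"
proof (induction b rule: poly_monom_induct)
  case (monom u i)
  show ?case
    by (induction c rule: poly_monom_induct)
       (simp_all add: mult_monom weyl_s_of_poly_monom mult_single weyl_const_mult
         weyl_s_of_poly_add distrib_left)
qed (simp add: weyl_s_of_poly_add distrib_right)

lemma weyl_s_of_poly_central:
  "weyl_s_of_poly b * Q = (Q * weyl_s_of_poly b :: ('n::linorder, 'k::field) weyl_s)"
proof (induction b rule: poly_monom_induct)
  case (monom u i)
  show ?case
    by (induction Q rule: poly_mapping_add_induct)
       (simp_all add: weyl_s_of_poly_monom mult_single weyl_const_central add.commute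
         distrib_left distrib_right)
qed (simp add: weyl_s_of_poly_add algebra_simps)

section \<open>The substitution \<open>s = c\<close>\<close>

lemma subst_s_monomial [simp]: "subst_s c (monomial j A) = A * weyl_const (c ^ j)"
  unfolding subst_s_def
  by (rule keys_sum_single[where g = "\<lambda>j A. A * weyl_const (c ^ j)"]) simp

lemma subst_s_add: "subst_s c (P + Q) = subst_s c P + subst_s c Q"
  unfolding subst_s_def
  by (rule keys_sum_add[where g = "\<lambda>j A. A * weyl_const (c ^ j)"]) (simp_all add: algebra_simps)

lemma subst_s_0 [simp]: "subst_s c 0 = 0"
  by (simp add: subst_s_def)

lemma subst_s_1 [simp]: "subst_s c 1 = 1"
  using subst_s_monomial[of c 0 1] by simp

lemma subst_s_mult: "subst_s c (P * Q) = subst_s c P * subst_s c Q"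
proof (induction P rule: poly_mapping_add_induct)
  case (single i A)
  show ?case
  proof (induction Q rule: poly_mapping_add_induct)
    case (single j B)
    show ?case
      by (simp add: mult_single power_add weyl_const_mult)
         (metis mult.assoc weyl_const_central)
  qed (simp add: distrib_left subst_s_add)
qed (simp add: distrib_right subst_s_add)

lemma subst_s_of_poly: "subst_s c (weyl_s_of_poly b) = weyl_const (poly b c)"
  by (induction b rule: poly_monom_induct)
     (simp_all add: weyl_s_of_poly_monom weyl_s_of_poly_add subst_s_add poly_monom
       weyl_const_mult weyl_const_add)

text \<open>
  By additivity it suffices to treat \<open>A s\<^sup>j\<close>, where the difference is \<open>A (c\<^sup>j - s\<^sup>j)\<close> and the second
  factor is a polynomial that vanishes at \<open>c\<close>.
\<close>

lemma subst_s_cong: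
  "\<exists>Q. monomial 0 (subst_s c P) - P = Q * weyl_s_of_poly [:- c, 1:]"
proof (induction P rule: poly_mapping_add_induct)
  case (single j A)
  let ?p = "Polynomial.monom (c ^ j) 0 - Polynomial.monom 1 j"
  have "poly ?p c = 0" by (simp add: poly_monom)
  then obtain q where q: "?p = q * [:- c, 1:]"
    by (metis poly_eq_0_iff_dvd dvdE mult.commute)
  have "monomial 0 (subst_s c (monomial j A)) - monomial j A
      = monomial 0 A * weyl_s_of_poly ?p"
    by (simp only: weyl_s_of_poly_diff weyl_s_of_poly_monom right_diff_distrib mult_single
        subst_s_monomial) simp
  also have "\<dots> = (monomial 0 A * weyl_s_of_poly q) * weyl_s_of_poly [:- c, 1:]"
    by (simp only: q weyl_s_of_poly_mult mult.assoc)
  finally show ?case by blast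
next
  case (add P P')
  then obtain Q Q' where "monomial 0 (subst_s c P) - P = Q * weyl_s_of_poly [:- c, 1:]"
    "monomial 0 (subst_s c P') - P' = Q' * weyl_s_of_poly [:- c, 1:]"
    by blast
  then have "monomial 0 (subst_s c (P + P')) - (P + P') = (Q + Q') * weyl_s_of_poly [:- c, 1:]"
    unfolding distrib_right subst_s_add single_add by (metis add_diff_add)
  then show ?case by blast
qed

text \<open>
  The two properness conditions are compared through preimages: the preimage of the ideal on the
  right under \<open>P(s) \<mapsto> P(c)\<close>, and the preimage of the ideal on the left under the inclusion of
  \<open>D\<^sub>n\<close> into \<open>D\<^sub>n[s]\<close>, are left ideals.
\<close>

lemma one_in_left_ideal_gen_subst_s_iff:
  "1 \<in> left_ideal_gen (insert (weyl_s_of_poly [:- c, 1:]) S)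
     \<longleftrightarrow> 1 \<in> left_ideal_gen (subst_s c ` S)"
  (is "1 \<in> ?I \<longleftrightarrow> 1 \<in> ?I'")
proof
  have I: "left_ideal ?I" and I': "left_ideal ?I'"
    by (rule left_ideal_left_ideal_gen)+
  show "1 \<in> ?I'" if "1 \<in> ?I"
  proof -
    have "left_ideal {P. subst_s c P \<in> ?I'}"
      using I' by (simp add: left_ideal_def subst_s_add subst_s_mult)
    moreover have "insert (weyl_s_of_poly [:- c, 1:]) S \<subseteq> {P. subst_s c P \<in> ?I'}"
      using left_ideal_gen_superset[of "subst_s c ` S"] I'
      by (auto simp: subst_s_of_poly left_ideal_def)
    ultimately have "?I \<subseteq> {P. subst_s c P \<in> ?I'}"
      by (intro left_ideal_gen_minimal)
    with that show ?thesis by auto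
  qed
  show "1 \<in> ?I" if "1 \<in> ?I'"
  proof -
    have "left_ideal {A. monomial 0 A \<in> ?I}"
      unfolding left_ideal_def
    proof (safe)
      show "monomial 0 0 \<in> ?I" using I by (simp add: left_ideal_def)
      show "monomial 0 (A + B) \<in> ?I" if "monomial 0 A \<in> ?I" "monomial 0 B \<in> ?I" for A B
        using I that by (simp add: left_ideal_def single_add)
      show "monomial 0 (R * A) \<in> ?I" if "monomial 0 A \<in> ?I" for R A
      proof -
        have "monomial 0 (R * A) = monomial 0 R * monomial (0::nat) A"
          by (simp add: mult_single)
        then show ?thesis using I that by (simp add: left_ideal_def)
      qed
    qed
    moreover have "monomial 0 (subst_s c P) \<in> ?I" if "P \<in> S" for P
    proof -
      obtain Q where "monomial 0 (subst_s c P) - P = Q * weyl_s_of_poly [:- c, 1:]"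
        using subst_s_cong by blast
      then have "monomial 0 (subst_s c P) = P + Q * weyl_s_of_poly [:- c, 1:]"
        by (simp add: algebra_simps)
      then show ?thesis
        using left_ideal_gen_superset[of S] that unfolding left_ideal_gen_insert by blast
    qed
    ultimately have "?I' \<subseteq> {A. monomial 0 A \<in> ?I}"
      by (intro left_ideal_gen_minimal) auto
    with that have "monomial 0 1 \<in> ?I" by blast
    then show ?thesis by simp
  qed
qed

section \<open>Functional equations and roots of the Bernstein--Sato polynomial\<close>

lemma has_functional_equation_iff:
  fixes f :: "('n::{finite, linorder}, 'k::field) mpoly"
  assumes "left_ideal_gen S = ann_f_power_s f"
  shows "has_functional_equation f c
    \<longleftrightarrow> weyl_s_of_poly c \<in> left_ideal_gen (insert (weyl_s_of_mpoly f) S)"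
proof -
  have "weyl_s_act f (Q * weyl_s_of_mpoly f) f_power_s = weyl_s_act f (weyl_s_of_poly c) f_power_s
    \<longleftrightarrow> weyl_s_of_poly c - Q * weyl_s_of_mpoly f \<in> ann_f_power_s f" for Q
    using weyl_s_act_add[of f "weyl_s_of_poly c" "- (Q * weyl_s_of_mpoly f)" f_power_s]
    by (auto simp: ann_f_power_s_def weyl_s_act_uminus)
  moreover have "(\<exists>Q. u - Q * v \<in> A)
      \<longleftrightarrow> u \<in> {a + q * v | a q. a \<in> A}" for u v and A :: "('n, 'k) weyl_s set"
  proof
    assume "\<exists>Q. u - Q * v \<in> A"
    then obtain Q where "u - Q * v \<in> A" by blast
    then show "u \<in> {a + q * v | a q. a \<in> A}"
      by (intro CollectI exI[of _ "u - Q * v"] exI[of _ Q]) simp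
  next
    assume "u \<in> {a + q * v | a q. a \<in> A}"
    then obtain a q where "u = a + q * v" "a \<in> A" by blast
    then show "\<exists>Q. u - Q * v \<in> A"
      by (intro exI[of _ q]) simp
  qed
  ultimately show ?thesis
    by (simp add: has_functional_equation_def left_ideal_gen_insert assms)
qed

text \<open>
  Division with remainder by \<open>s - c\<close> shows that the ideal contains the non-zero scalar \<open>p(c)\<close>.
\<close>

lemma left_ideal_UNIV_if_poly_nonzero:
  fixes I :: "('n::linorder, 'k::field) weyl_s set"
  assumes I: "left_ideal I" and s: "weyl_s_of_poly [:- c, 1:] \<in> I"
    and p: "weyl_s_of_poly p \<in> I" and nz: "poly p c \<noteq> 0"
  shows "I = UNIV"
proof -
  have mult: "weyl_s_of_poly (q * r) \<in> I" if "weyl_s_of_poly r \<in> I" for q r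
    using I that by (simp add: weyl_s_of_poly_mult left_ideal_def)
  have "poly (p - [:poly p c:]) c = 0" by simp
  then obtain q where "p - [:poly p c:] = q * [:- c, 1:]"
    by (metis poly_eq_0_iff_dvd dvdE mult.commute)
  then have "[:poly p c:] = p - q * [:- c, 1:]" by (simp only: algebra_simps)
  then have "weyl_s_of_poly [:poly p c:] \<in> I"
    using left_ideal_diff[OF I p mult[OF s, of q]] by (simp only: weyl_s_of_poly_diff)
  from mult[OF this, of "[:inverse (poly p c):]"] nz have "1 \<in> I"
    by (simp flip: one_pCons)
  then show ?thesis using left_ideal_eq_UNIV_iff[OF I] by simp
qed

text \<open>
  Were the ideal improper, multiplying a representation of \<open>1\<close> by the cofactor of \<open>s - c\<close> in \<open>b\<close>
  would produce a functional equation of degree smaller than that of \<open>b\<close>.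
\<close>

lemma one_notin_if_bernstein_sato_root:
  fixes f :: "('n::{finite, linorder}, 'k::field) mpoly"
  assumes b: "is_bernstein_sato_poly f b" and root: "poly b c = 0"
    and S: "left_ideal_gen S = ann_f_power_s f"
  shows "1 \<notin> left_ideal_gen (insert (weyl_s_of_poly [:- c, 1:]) (insert (weyl_s_of_mpoly f) S))"
proof
  let ?s = "weyl_s_of_poly [:- c, 1:]" and ?J = "left_ideal_gen (insert (weyl_s_of_mpoly f) S)"
  assume "1 \<in> left_ideal_gen (insert ?s (insert (weyl_s_of_mpoly f) S))"
  then obtain j q where j: "j \<in> ?J" and one: "1 = j + q * ?s"
    unfolding left_ideal_gen_insert[of ?s] by blast
  obtain d where d: "b = [:- c, 1:] * d"
    using root by (metis poly_eq_0_iff_dvd dvdE)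
  have "weyl_s_of_poly d = weyl_s_of_poly d * (j + q * ?s)"
    by (simp flip: one)
  also have "\<dots> = weyl_s_of_poly d * j + q * weyl_s_of_poly b"
    by (simp only: d distrib_left weyl_s_of_poly_mult)
       (metis mult.assoc weyl_s_of_poly_central)
  also have "\<dots> \<in> ?J"
  proof -
    have "weyl_s_of_poly b \<in> ?J"
      using b by (simp add: is_bernstein_sato_poly_def flip: has_functional_equation_iff[OF S])
    with j show ?thesis
      using left_ideal_left_ideal_gen[of "insert (weyl_s_of_mpoly f) S"] by (simp add: left_ideal_def)
  qed
  finally have fe: "has_functional_equation f d"
    by (simp add: has_functional_equation_iff[OF S])
  have monic: "lead_coeff b = 1"
    using b by (simp add: is_bernstein_sato_poly_def)
  then have "lead_coeff d = 1"
    unfolding d lead_coeff_mult by simp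
  with b fe have "degree b \<le> degree d"
    unfolding is_bernstein_sato_poly_def by blast
  moreover have "degree b = Suc (degree d)"
    using \<open>lead_coeff d = 1\<close> unfolding d by (subst degree_mult_eq) auto
  ultimately show False by simp
qed

section \<open>The characterisation of the roots\<close>

theorem corollary2p3:
  fixes f :: "('n::{finite, linorder}, 'k::field_char_0) mpoly"
    and b :: "'k poly"
    and P :: "nat \<Rightarrow> ('n, 'k) weyl_s"
    and k :: nat
    and \<alpha> :: rat
  assumes "f \<noteq> 0"
    and "is_bernstein_sato_poly f b"
    and "left_ideal_gen (P ` {1..k}) = ann_f_power_s f"
    and "\<alpha> > 0"
  shows "(poly (b \<circ>\<^sub>p [:0, -1:]) (of_rat \<alpha>) = 0 \<longleftrightarrow>
            left_ideal_gen (P ` {1..k} \<union> {weyl_s_of_mpoly f, weyl_s_of_poly [:of_rat \<alpha>, 1:]}) \<noteq> UNIV)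
       \<and> (left_ideal_gen (P ` {1..k} \<union> {weyl_s_of_mpoly f, weyl_s_of_poly [:of_rat \<alpha>, 1:]}) \<noteq> UNIV \<longleftrightarrow>
            left_ideal_gen ((\<lambda>i. subst_s (- of_rat \<alpha>) (P i)) ` {1..k} \<union> {weyl_of_mpoly f}) \<noteq> UNIV)
       \<and> (poly (b \<circ>\<^sub>p [:0, -1:]) (of_rat \<alpha>) = 0 \<longrightarrow>
            left_ideal_gen (P ` {1..k} \<union> {weyl_s_of_mpoly f, weyl_s_of_poly [:of_rat \<alpha>, 1:]}) \<inter> range weyl_s_of_poly
              = weyl_s_of_poly ` left_ideal_gen {[:of_rat \<alpha>, 1:]})"
proof -
  define c :: 'k where "c = - of_rat \<alpha>"
  define F where "F = weyl_s_of_mpoly f"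
  define t :: "('n, 'k) weyl_s" where "t = weyl_s_of_poly [:- c, 1:]"
  define S where "S = insert F (P ` {1..k})"
  define I where "I = left_ideal_gen (insert t S)"
  have gens: "P ` {1..k} \<union> {weyl_s_of_mpoly f, weyl_s_of_poly [:of_rat \<alpha>, 1:]} = insert t S"
    by (auto simp: S_def F_def t_def c_def)
  have subst_gens: "(\<lambda>i. subst_s (- of_rat \<alpha>) (P i)) ` {1..k} \<union> {weyl_of_mpoly f} = subst_s c ` S"
    by (auto simp: S_def F_def c_def weyl_s_of_mpoly_def)
  have root: "poly (b \<circ>\<^sub>p [:0, -1:]) (of_rat \<alpha>) = poly b c"
    by (simp add: poly_pcompose c_def)
  have I: "left_ideal I" and t: "t \<in> I"
    using left_ideal_left_ideal_gen left_ideal_gen_superset[of "insert t S"] by (auto simp: I_def)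
  have nonzero: "I = UNIV" if "weyl_s_of_poly p \<in> I" "poly p c \<noteq> 0" for p
    using left_ideal_UNIV_if_poly_nonzero[OF I t[unfolded t_def] that] .
  have "has_functional_equation f b"
    using assms(2) by (simp add: is_bernstein_sato_poly_def)
  then have "weyl_s_of_poly b \<in> left_ideal_gen S"
    by (simp add: has_functional_equation_iff[OF assms(3)] S_def F_def)
  moreover have "left_ideal_gen S \<subseteq> I"
    using I left_ideal_gen_superset[of "insert t S"]
    by (auto simp: I_def intro!: left_ideal_gen_minimal del: subsetI)
  ultimately have "weyl_s_of_poly b \<in> I" by blast
  then have "poly b c = 0" if "I \<noteq> UNIV"
    using nonzero that by blast
  moreover have "I \<noteq> UNIV" if "poly b c = 0"
    using one_notin_if_bernstein_sato_root[OF assms(2) that assms(3)]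
    unfolding I_def S_def F_def t_def by blast
  ultimately have 12: "poly b c = 0 \<longleftrightarrow> I \<noteq> UNIV"
    by blast
  have 23: "I \<noteq> UNIV \<longleftrightarrow> left_ideal_gen (subst_s c ` S) \<noteq> UNIV"
    unfolding I_def t_def
    by (simp add: left_ideal_eq_UNIV_iff[OF left_ideal_left_ideal_gen]
        one_in_left_ideal_gen_subst_s_iff)
  have "I \<inter> range weyl_s_of_poly = weyl_s_of_poly ` left_ideal_gen {[:- c, 1:]}" if "I \<noteq> UNIV"
  proof
    show "I \<inter> range weyl_s_of_poly \<subseteq> weyl_s_of_poly ` left_ideal_gen {[:- c, 1:]}"
    proof
      fix x assume "x \<in> I \<inter> range weyl_s_of_poly"
      then obtain p where x: "x = weyl_s_of_poly p" and "weyl_s_of_poly p \<in> I" by blast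
      then have "poly p c = 0" using nonzero that by blast
      then obtain q where "p = q * [:- c, 1:]"
        by (metis poly_eq_0_iff_dvd dvdE mult.commute)
      then show "x \<in> weyl_s_of_poly ` left_ideal_gen {[:- c, 1:]}"
        unfolding x left_ideal_gen_singleton by blast
    qed
    show "weyl_s_of_poly ` left_ideal_gen {[:- c, 1:]} \<subseteq> I \<inter> range weyl_s_of_poly"
      using I t unfolding left_ideal_gen_singleton
      by (auto simp only: weyl_s_of_poly_mult left_ideal_def t_def)
  qed
  with 12 23 show ?thesis
    unfolding gens subst_gens root I_def[symmetric] by (simp add: c_def)
qed

end
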